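(* We have the group inclusion $L_n\unlhd M_n$ and $[M_n:L_n]=2$.
   Context: Let $\mathcal{T}$ be the rooted $3$-ary tree whose vertices are words over $X=\{0,1,2\}$, and $\mathcal{T}_n$ its truncation at level $n$. Via sections, $\mathrm{Aut}(\mathcal{T}_n)\cong(\mathrm{Aut}(\mathcal{T}_{n-1})\times\mathrm{Aut}(\mathcal{T}_{n-1})\times\mathrm{Aut}(\mathcal{T}_{n-1}))\rtimes S_3$, and an element is written $(\sigma_0,\sigma_1,\sigma_2)\pi$ with $\sigma_i\in\mathrm{Aut}(\mathcal{T}_{n-1})$ (the section at vertex $i$) and $\pi\in S_3$ (action on the first level). $\mathrm{Aut}(\mathcal{T}_{n-1})$ is embedded in $\mathrm{Aut}(\mathcal{T}_n)$ by $\sigma\mapsto(\sigma,\mathrm{id},\mathrm{id})$. Define elements recursively by $x_1=(0,1,2)$, $y_1=(0,1)$, $z_1=\mathrm{id}$ in $S_3=\mathrm{Aut}(\mathcal{T}_1)$, and for $n\ge 2$: $x_n=(\mathrm{id},\mathrm{id},x_{n-1})(0,1,2)$, $y_n=(\mathrm{id},y_{n-1},x_{n-1})(0,1)$, $z_n=(y_{n-1},y_{n-1},x_{n-1})$ (these are the iterates, under the Markov model for a PCF cubic with combined critical orbit of length one, of the elements $(0,1,2)$, $(0,1)$, $\mathrm{id}$ carrying types $[s,3]$, $[n,2][s,1]$, $[n,1]^2[s,1]$ respectively). Let $L_0$ be trivial, $L_n=\langle x_n,z_n,L_{n-1}\rangle$ and $M_n=\langle x_n,y_n,z_n,L_{n-1}\rangle$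 (so $M_1=S_3$). *)

theory Defs
  imports "HOL-Algebra.Bij" "HOL-Algebra.Generated_Groups" "HOL-Combinatorics.Cycles"
begin

definition tree_verts :: "nat \<Rightarrow> nat list set" where
  "tree_verts n = {w. set w \<subseteq> {0, 1, 2} \<and> length w \<le> n}"

definition tree_adj :: "nat list \<Rightarrow> nat list \<Rightarrow> bool" where
  "tree_adj u v \<longleftrightarrow> (\<exists>i. v = u @ [i]) \<or> (\<exists>i. u = v @ [i])"

definition tree_aut :: "nat \<Rightarrow> (nat list \<Rightarrow> nat list) monoid" where
  "tree_aut n = (BijGroup (tree_verts n))
     \<lparr>carrier := {f \<in> Bij (tree_verts n). f [] = [] \<and>
        (\<forall>u \<in> tree_verts n. \<forall>v \<in> tree_verts n. tree_adj (f u) (f v) \<longleftrightarrow> tree_adj u v)}\<rparr>"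

abbreviation tree_id :: "nat \<Rightarrow> nat list \<Rightarrow> nat list" where
  "tree_id n \<equiv> \<one>\<^bsub>tree_aut n\<^esub>"

text \<open>
  The element \<open>(s\<^sub>0, s\<^sub>1, s\<^sub>2) \<pi>\<close> of the automorphism group of the tree truncated at level \<open>n\<close>,
  where \<open>s\<^sub>i\<close> is the section at the vertex \<open>i\<close>, that is, \<open>i v \<mapsto> \<pi>(i) s\<^sub>i(v)\<close>.
  Whether automorphisms are composed from the left or from the right does not affect the
  subgroups generated by a set of them.
\<close>
definition from_sections ::
    "nat \<Rightarrow> (nat list \<Rightarrow> nat list) \<Rightarrow> (nat list \<Rightarrow> nat list) \<Rightarrow> (nat list \<Rightarrow> nat list)
      \<Rightarrow> (nat \<Rightarrow> nat) \<Rightarrow> (nat list \<Rightarrow> nat list)" where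
  "from_sections n s\<^sub>0 s\<^sub>1 s\<^sub>2 \<pi> =
     (\<lambda>w \<in> tree_verts n. case w of [] \<Rightarrow> [] | i # v \<Rightarrow> \<pi> i # ([s\<^sub>0, s\<^sub>1, s\<^sub>2] ! i) v)"

definition level_one :: "(nat \<Rightarrow> nat) \<Rightarrow> (nat list \<Rightarrow> nat list)" where
  "level_one \<pi> = from_sections 1 (tree_id 0) (tree_id 0) (tree_id 0) \<pi>"

definition tree_embed :: "nat \<Rightarrow> (nat list \<Rightarrow> nat list) \<Rightarrow> (nat list \<Rightarrow> nat list)" where
  "tree_embed n \<sigma> = from_sections n \<sigma> (tree_id (n - 1)) (tree_id (n - 1)) id"

text \<open>The values at index \<open>0\<close> in the following three definitions are dummies.\<close>

fun x_elt :: "nat \<Rightarrow> nat list \<Rightarrow> nat list" where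
  "x_elt 0 = tree_id 0"
| "x_elt (Suc 0) = level_one (cycle_of_list [0, 1, 2])"
| "x_elt (Suc (Suc n)) =
     from_sections (Suc (Suc n)) (tree_id (Suc n)) (tree_id (Suc n)) (x_elt (Suc n))
       (cycle_of_list [0, 1, 2])"

fun y_elt :: "nat \<Rightarrow> nat list \<Rightarrow> nat list" where
  "y_elt 0 = tree_id 0"
| "y_elt (Suc 0) = level_one (cycle_of_list [0, 1])"
| "y_elt (Suc (Suc n)) =
     from_sections (Suc (Suc n)) (tree_id (Suc n)) (y_elt (Suc n)) (x_elt (Suc n))
       (cycle_of_list [0, 1])"

fun z_elt :: "nat \<Rightarrow> nat list \<Rightarrow> nat list" where
  "z_elt 0 = tree_id 0"
| "z_elt (Suc 0) = tree_id 1"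
| "z_elt (Suc (Suc n)) =
     from_sections (Suc (Suc n)) (y_elt (Suc n)) (y_elt (Suc n)) (x_elt (Suc n)) id"

fun L_grp :: "nat \<Rightarrow> (nat list \<Rightarrow> nat list) set" where
  "L_grp 0 = {tree_id 0}"
| "L_grp (Suc n) = generate (tree_aut (Suc n))
     ({x_elt (Suc n), z_elt (Suc n)} \<union> tree_embed (Suc n) ` L_grp n)"

text \<open>Meaningful for \<open>n \<ge> 1\<close> only.\<close>
definition M_grp :: "nat \<Rightarrow> (nat list \<Rightarrow> nat list) set" where
  "M_grp n = generate (tree_aut n)
     ({x_elt n, y_elt n, z_elt n} \<union> tree_embed n ` L_grp (n - 1))"

end

theory Submission
  imports Defs
begin

text \<open>
  It suffices that \<open>y\<^sub>n\<close> normalises \<open>L\<^sub>n\<close>, that its square lies in \<open>L\<^sub>n\<close> and that it does not lie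
  there itself.  Write \<open>(a, b, c)\<close> for the automorphism with sections \<open>a\<close>, \<open>b\<close>, \<open>c\<close> that fixes
  the first level, \<open>x\<close>, \<open>y\<close> for \<open>x\<^sub>n\<close>, \<open>y\<^sub>n\<close>, and \<open>X\<close>, \<open>Y\<close>, \<open>Z\<close> for \<open>x\<^sub>n\<^sub>+\<^sub>1\<close>, \<open>y\<^sub>n\<^sub>+\<^sub>1\<close>,
  \<open>z\<^sub>n\<^sub>+\<^sub>1\<close>.  Conjugation by \<open>X\<close> takes \<open>(a, b, c)\<close> to \<open>(x c x\<^sup>-\<^sup>1, a, b)\<close>, so it moves the embedded
  copy of \<open>L\<^sub>n\<close> to all three branches and \<open>L\<^sub>n \<times> L\<^sub>n \<times> L\<^sub>n\<close> lies in \<open>L\<^sub>n\<^sub>+\<^sub>1\<close>.  As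
  \<open>Y Y = Z (id, id, x)\<close>, the squares of all the \<open>y\<^sub>n\<close> lie in \<open>L\<^sub>n\<close>.  Conjugation by \<open>Y\<close> takes
  \<open>(a, b, c)\<close> to \<open>(y b y\<^sup>-\<^sup>1, a, x c x\<^sup>-\<^sup>1)\<close> and \<open>X\<close> to \<open>X\<^sup>-\<^sup>1 (x\<^sup>2 y\<^sup>-\<^sup>2, id, x\<^sup>-\<^sup>1) Z\<close>, so \<open>Y\<close>
  normalises \<open>L\<^sub>n\<^sub>+\<^sub>1\<close>.  Finally \<open>Y\<close> is not in \<open>L\<^sub>n\<^sub>+\<^sub>1\<close>, because it acts on the first level by
  an odd permutation and \<open>L\<^sub>n\<^sub>+\<^sub>1\<close> by even ones.
\<close>

declare One_nat_def [simp del]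

section \<open>Subgroups of index two\<close>

context group
begin

lemma inv_mult_cancel_left:
  "\<lbrakk>a \<in> carrier G; b \<in> carrier G\<rbrakk> \<Longrightarrow> inv a \<otimes> (a \<otimes> b) = b"
  by (simp flip: m_assoc)

lemma subgroup_conj_vimage:
  assumes H: "subgroup H G" and y: "y \<in> carrier G"
  shows "subgroup {g \<in> carrier G. y \<otimes> g \<otimes> inv y \<in> H} G" (is "subgroup ?K G")
proof (rule subgroupI)
  have "\<one> \<in> ?K" using y subgroup.one_closed[OF H] by simp
  then show "?K \<noteq> {}" by blast
next
  fix g assume g: "g \<in> ?K"
  then have "inv (y \<otimes> g \<otimes> inv y) \<in> H" using subgroup.m_inv_closed[OF H] by blast
  moreover have "inv (y \<otimes> g \<otimes> inv y) = y \<otimes> inv g \<otimes> inv y"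
    using g y by (simp add: inv_mult_group m_assoc)
  ultimately show "inv g \<in> ?K" using g by simp
next
  fix g h assume gh: "g \<in> ?K" "h \<in> ?K"
  then have "(y \<otimes> g \<otimes> inv y) \<otimes> (y \<otimes> h \<otimes> inv y) \<in> H"
    using subgroup.m_closed[OF H] by blast
  moreover have "(y \<otimes> g \<otimes> inv y) \<otimes> (y \<otimes> h \<otimes> inv y) = y \<otimes> (g \<otimes> h) \<otimes> inv y"
    using gh y by (simp add: m_assoc inv_mult_cancel_left)
  ultimately show "g \<otimes> h \<in> ?K" using gh by simp
qed blast

lemma generate_conj_closed:
  assumes S: "S \<subseteq> carrier G" and H: "subgroup H G" and y: "y \<in> carrier G"
    and conj: "\<And>s. s \<in> S \<Longrightarrow> y \<otimes> s \<otimes> inv y \<in> H" and g: "g \<in> generate G S"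
  shows "y \<otimes> g \<otimes> inv y \<in> H"
  using generate_subgroup_incl[OF _ subgroup_conj_vimage[OF H y], of S] S conj g by blast

lemma mult_mem_Un_r_coset:
  assumes H: "subgroup H G" and y: "y \<in> carrier G"
    and h: "h \<in> H" and k: "k \<in> H \<union> (H #> y)"
  shows "h \<otimes> k \<in> H \<union> (H #> y)"
  using k
proof
  assume "k \<in> H #> y"
  then obtain h' where h': "h' \<in> H" "k = h' \<otimes> y" by (auto simp: r_coset_def)
  then have "h \<otimes> k = (h \<otimes> h') \<otimes> y"
    using h y by (simp add: m_assoc subgroup.mem_carrier[OF H])
  then show ?thesis
    using rcosI[OF subgroup.m_closed[OF H h h'(1)] subgroup.subset[OF H] y] by simp
qed (use subgroup.m_closed[OF H h] in blast)

context
  fixes H y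
  assumes H: "subgroup H G" and y: "y \<in> carrier G"
    and conj: "\<And>h. h \<in> H \<Longrightarrow> y \<otimes> h \<otimes> inv y \<in> H" and sq: "y \<otimes> y \<in> H"
begin

lemma normalizing_mult_mem_Un_r_coset:
  assumes "k \<in> H \<union> (H #> y)"
  shows "y \<otimes> k \<in> H \<union> (H #> y)"
  using assms
proof
  assume k: "k \<in> H"
  then have "y \<otimes> k = (y \<otimes> k \<otimes> inv y) \<otimes> y"
    using y by (simp add: m_assoc subgroup.mem_carrier[OF H])
  then show ?thesis using rcosI[OF conj[OF k] subgroup.subset[OF H] y] by simp
next
  assume "k \<in> H #> y"
  then obtain h where h: "h \<in> H" "k = h \<otimes> y" by (auto simp: r_coset_def)
  then have "y \<otimes> k = (y \<otimes> h \<otimes> inv y) \<otimes> (y \<otimes> y)"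
    using y by (simp add: m_assoc inv_mult_cancel_left subgroup.mem_carrier[OF H])
  then show ?thesis using subgroup.m_closed[OF H conj[OF h(1)] sq] by simp
qed

lemma subgroup_Un_r_coset: "subgroup (H \<union> (H #> y)) G" (is "subgroup ?K G")
proof (rule subgroupI)
  show "?K \<subseteq> carrier G"
    using subgroup.subset[OF H] r_coset_subset_G[OF subgroup.subset[OF H] y] by blast
  show "?K \<noteq> {}" using subgroup.one_closed[OF H] by blast
next
  fix k assume "k \<in> ?K"
  then show "inv k \<in> ?K"
  proof
    assume "k \<in> H #> y"
    then obtain h where h: "h \<in> H" "k = h \<otimes> y" by (auto simp: r_coset_def)
    then have "inv k = inv (y \<otimes> y) \<otimes> (y \<otimes> inv h)"
      using y subgroup.mem_carrier[OF H h(1)]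
      by (simp add: inv_mult_group m_assoc inv_mult_cancel_left)
    moreover have "y \<otimes> inv h \<in> ?K"
      using normalizing_mult_mem_Un_r_coset subgroup.m_inv_closed[OF H h(1)] by blast
    ultimately show ?thesis
      using mult_mem_Un_r_coset[OF H y subgroup.m_inv_closed[OF H sq]] by simp
  qed (use subgroup.m_inv_closed[OF H] in blast)
next
  fix k k' assume k: "k \<in> ?K" and k': "k' \<in> ?K"
  from k show "k \<otimes> k' \<in> ?K"
  proof
    assume "k \<in> H #> y"
    then obtain h where h: "h \<in> H" "k = h \<otimes> y" by (auto simp: r_coset_def)
    have "k' \<in> carrier G" using k' y subgroup.mem_carrier[OF H] by (auto simp: r_coset_def)
    then have "k \<otimes> k' = h \<otimes> (y \<otimes> k')"
      using h y by (simp add: m_assoc subgroup.mem_carrier[OF H])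
    then show ?thesis
      using mult_mem_Un_r_coset[OF H y h(1) normalizing_mult_mem_Un_r_coset[OF k']] by simp
  qed (use mult_mem_Un_r_coset[OF H y _ k'] in blast)
qed

end

lemma generate_insert_eq_Un_r_coset:
  assumes S: "S \<subseteq> carrier G" and y: "y \<in> carrier G"
    and conj: "\<And>s. s \<in> S \<Longrightarrow> y \<otimes> s \<otimes> inv y \<in> generate G S"
    and sq: "y \<otimes> y \<in> generate G S"
  shows "generate G (insert y S) = generate G S \<union> (generate G S #> y)" (is "?M = ?H \<union> _")
proof
  have H: "subgroup ?H G" by (rule generate_is_subgroup[OF S])
  have M: "subgroup ?M G" using S y by (intro generate_is_subgroup) auto
  have "insert y S \<subseteq> ?H \<union> (?H #> y)" using rcos_self[OF y H] by (auto intro: generate.incl)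
  then show "?M \<subseteq> ?H \<union> (?H #> y)"
    using generate_conj_closed[OF S H y conj]
    by (intro generate_subgroup_incl subgroup_Un_r_coset H y sq)
  have "?H \<subseteq> ?M" by (rule mono_generate) auto
  moreover have "y \<in> ?M" by (rule generate.incl) simp
  ultimately show "?H \<union> (?H #> y) \<subseteq> ?M"
    using subgroup.m_closed[OF M] by (auto simp: r_coset_def)
qed

lemma card_rcosets_eq_two:
  assumes H: "subgroup H G" and y: "y \<in> carrier G" "y \<notin> H"
    and G: "carrier G = H \<union> (H #> y)"
  shows "card (rcosets H) = 2"
proof -
  have "rcosets H = (\<lambda>g. H #> g) ` carrier G" by (auto simp: RCOSETS_def)
  also have "\<dots> = (\<lambda>g. H #> g) ` H \<union> (\<lambda>g. H #> g) ` (H #> y)" by (subst G) (rule image_Un)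
  also have "(\<lambda>g. H #> g) ` H = {H}"
    using coset_join2[OF _ H] subgroup.mem_carrier[OF H] subgroup.one_closed[OF H] by force
  also have "(\<lambda>g. H #> g) ` (H #> y) = {H #> y}"
    using repr_independence[OF _ y(1) H] rcos_self[OF y(1) H] by blast
  finally have "rcosets H = {H, H #> y}" by auto
  moreover have "H \<noteq> H #> y" using y rcos_self[OF y(1) H] by blast
  ultimately show ?thesis by simp
qed

lemma r_coset_eq_if_card_rcosets_eq_two:
  assumes H: "subgroup H G" and two: "card (rcosets H) = 2"
    and g: "g \<in> carrier G" "g \<notin> H" and g': "g' \<in> carrier G" "g' \<notin> H"
  shows "H #> g = H #> g'"
proof -
  have coset: "H #> a \<in> rcosets H" if "a \<in> carrier G" for a
    using rcosetsI[OF subgroup.subset[OF H] that] .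
  have "H #> g \<noteq> H" "H #> g' \<noteq> H" using coset_join1[OF _ _ H] g g' by blast+
  moreover have "H \<in> rcosets H"
    using coset[OF one_closed] coset_mult_one[OF subgroup.subset[OF H]] by simp
  moreover obtain U V where UV: "rcosets H = {U, V}" using two unfolding card_2_iff by blast
  ultimately show ?thesis
    using coset[OF g(1)] coset[OF g'(1)] unfolding UV by (metis insert_iff singletonD)
qed

lemma normal_if_card_rcosets_eq_two:
  assumes H: "subgroup H G" and two: "card (rcosets H) = 2"
  shows "H \<lhd> G"
proof (rule normal_invI[OF H])
  fix g h assume g: "g \<in> carrier G" and h: "h \<in> H"
  have hc: "h \<in> carrier G" by (rule subgroup.mem_carrier[OF H h])
  show "g \<otimes> h \<otimes> inv g \<in> H"
  proof (rule ccontr)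
    assume conj: "g \<otimes> h \<otimes> inv g \<notin> H"
    then have "g \<notin> H" using H h by (auto simp: subgroup.m_closed subgroup.m_inv_closed)
    then have "inv g \<notin> H" using g subgroup.m_inv_closed[OF H, of "inv g"] by auto
    with conj have "H #> (g \<otimes> h \<otimes> inv g) = H #> inv g"
      using g hc by (intro r_coset_eq_if_card_rcosets_eq_two[OF H two]) simp_all
    then have "g \<otimes> h \<otimes> inv g \<in> H #> inv g"
      using rcos_self[of "g \<otimes> h \<otimes> inv g" H] g hc H by simp
    then obtain k where k: "k \<in> H" "g \<otimes> h \<otimes> inv g = k \<otimes> inv g" by (auto simp: r_coset_def)
    then have "g \<otimes> h = k" using g hc subgroup.mem_carrier[OF H k(1)] by simp
    then have "g = k \<otimes> inv h"
      using g hc subgroup.mem_carrier[OF H k(1)] by (simp add: inv_solve_right)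
    then have "g \<in> H" using H h k(1) by (simp add: subgroup.m_closed subgroup.m_inv_closed)
    then show False using \<open>g \<notin> H\<close> by contradiction
  qed
qed

lemma generate_insert_index_two:
  assumes S: "S \<subseteq> carrier G" and y: "y \<in> carrier G"
    and conj: "\<And>s. s \<in> S \<Longrightarrow> y \<otimes> s \<otimes> inv y \<in> generate G S"
    and sq: "y \<otimes> y \<in> generate G S"
    and notin: "y \<notin> generate G S"
  shows "generate G S \<lhd> G\<lparr>carrier := generate G (insert y S)\<rparr>" (is "?H \<lhd> ?M")
    and "card (rcosets\<^bsub>G\<lparr>carrier := generate G (insert y S)\<rparr>\<^esub> generate G S) = 2"
proof -
  have sub: "subgroup (carrier ?M) G" using S y by (auto intro: generate_is_subgroup)
  interpret M: group ?M using subgroup_imp_group[OF sub] by simp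
  have H: "subgroup ?H ?M"
    using subgroup_incl[OF generate_is_subgroup[OF S] sub] mono_generate[of S "insert y S"]
    by auto
  moreover have "y \<in> carrier ?M" by (simp add: generate.incl)
  moreover have "carrier ?M = ?H \<union> (?H #>\<^bsub>?M\<^esub> y)"
    using generate_insert_eq_Un_r_coset[OF S y conj sq] by (simp add: r_coset_def)
  ultimately show two: "card (rcosets\<^bsub>?M\<^esub> ?H) = 2" using notin by (intro M.card_rcosets_eq_two)
  show "?H \<lhd> ?M" by (rule M.normal_if_card_rcosets_eq_two[OF H two])
qed

end

section \<open>The automorphism group of the truncated tree\<close>

lemma subgroup_relation_automorphisms:
  "subgroup {f \<in> Bij S. \<forall>u\<in>S. \<forall>v\<in>S. R (f u) (f v) \<longleftrightarrow> R u v} (BijGroup S)"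
    (is "subgroup ?A _")
proof -
  interpret B: group "BijGroup S" by (rule group_BijGroup)
  show ?thesis
  proof (rule B.subgroupI)
    show "?A \<subseteq> carrier (BijGroup S)" by (auto simp: BijGroup_def)
    show "?A \<noteq> {}" using id_Bij[of S] by force
  next
    fix f assume f: "f \<in> ?A"
    have inv: "inv_into S f w \<in> S \<and> f (inv_into S f w) = w" if "w \<in> S" for w
      using f that by (auto simp: Bij_def bij_betw_def inv_into_into f_inv_into_f)
    have "R (inv_into S f u) (inv_into S f v) \<longleftrightarrow> R u v" if "u \<in> S" "v \<in> S" for u v
      using f inv[OF that(1)] inv[OF that(2)] by force
    then show "inv\<^bsub>BijGroup S\<^esub> f \<in> ?A"
      using f by (simp add: inv_BijGroup restrict_inv_into_Bij)
  next
    fix f g assume f: "f \<in> ?A" and g: "g \<in> ?A"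
    have "g w \<in> S" if "w \<in> S" for w using g that Bij_imp_funcset by blast
    then have "compose S f g \<in> ?A" using f g by (simp add: compose_Bij compose_eq)
    then show "f \<otimes>\<^bsub>BijGroup S\<^esub> g \<in> ?A" using f g by (simp add: BijGroup_def)
  qed
qed

lemma Nil_in_tree_verts [simp]: "[] \<in> tree_verts n"
  by (simp add: tree_verts_def)

lemma Cons_in_tree_verts_iff:
  "i # v \<in> tree_verts (Suc n) \<longleftrightarrow> i \<in> {0, 1, 2} \<and> v \<in> tree_verts n"
  by (auto simp: tree_verts_def)

lemma singleton_in_tree_verts_iff: "[i] \<in> tree_verts (Suc n) \<longleftrightarrow> i \<in> {0, 1, 2}"
  by (simp add: Cons_in_tree_verts_iff)

lemma tree_verts_Suc_cases [consumes 1, case_names Nil Cons]: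
  assumes "w \<in> tree_verts (Suc n)"
  obtains "w = []" | i v where "w = i # v" "i \<in> {0, 1, 2}" "v \<in> tree_verts n"
proof (cases w)
  case (Cons i v)
  then show ?thesis using assms that(2) unfolding Cons Cons_in_tree_verts_iff by blast
qed (use that in blast)

lemma finite_tree_verts: "finite (tree_verts n)"
  unfolding tree_verts_def by (rule finite_lists_length_le) simp

lemma in_carrier_tree_aut_iff:
  "f \<in> carrier (tree_aut n) \<longleftrightarrow> f \<in> Bij (tree_verts n) \<and> f [] = [] \<and>
     (\<forall>u \<in> tree_verts n. \<forall>v \<in> tree_verts n. tree_adj (f u) (f v) \<longleftrightarrow> tree_adj u v)"
  by (simp add: tree_aut_def)

lemma tree_aut_carrierI:
  assumes "f \<in> extensional (tree_verts n)" "f [] = []"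
    and "\<And>w. w \<in> tree_verts n \<Longrightarrow> f w \<in> tree_verts n" "inj_on f (tree_verts n)"
    and "\<And>u v. \<lbrakk>u \<in> tree_verts n; v \<in> tree_verts n\<rbrakk> \<Longrightarrow> tree_adj (f u) (f v) \<longleftrightarrow> tree_adj u v"
  shows "f \<in> carrier (tree_aut n)"
  using assms endo_inj_surj[OF finite_tree_verts, of f n]
  by (auto simp: in_carrier_tree_aut_iff Bij_def bij_betw_def)

lemma tree_aut_one: "tree_id n = (\<lambda>w \<in> tree_verts n. w)"
  by (simp add: tree_aut_def BijGroup_def)

lemma tree_aut_mult:
  "\<lbrakk>f \<in> carrier (tree_aut n); g \<in> carrier (tree_aut n)\<rbrakk>
     \<Longrightarrow> f \<otimes>\<^bsub>tree_aut n\<^esub> g = compose (tree_verts n) f g"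
  by (simp add: tree_aut_def BijGroup_def)

lemma tree_aut_Nil: "f \<in> carrier (tree_aut n) \<Longrightarrow> f [] = []"
  by (simp add: in_carrier_tree_aut_iff)

lemma tree_aut_closed:
  "\<lbrakk>f \<in> carrier (tree_aut n); w \<in> tree_verts n\<rbrakk> \<Longrightarrow> f w \<in> tree_verts n"
  by (auto simp: in_carrier_tree_aut_iff dest: Bij_imp_funcset)

lemma tree_aut_eq_iff:
  "\<lbrakk>f \<in> carrier (tree_aut n); v \<in> tree_verts n; w \<in> tree_verts n\<rbrakk> \<Longrightarrow> f v = f w \<longleftrightarrow> v = w"
  by (auto simp: in_carrier_tree_aut_iff Bij_def bij_betw_def inj_on_def)

lemma tree_aut_eq_Nil_iff:
  "\<lbrakk>f \<in> carrier (tree_aut n); w \<in> tree_verts n\<rbrakk> \<Longrightarrow> f w = [] \<longleftrightarrow> w = []"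
  using tree_aut_eq_iff[of f n w "[]"] by (simp add: tree_aut_Nil)

lemma tree_aut_adj_iff:
  "\<lbrakk>f \<in> carrier (tree_aut n); u \<in> tree_verts n; v \<in> tree_verts n\<rbrakk>
     \<Longrightarrow> tree_adj (f u) (f v) \<longleftrightarrow> tree_adj u v"
  by (simp add: in_carrier_tree_aut_iff)

lemma group_tree_aut: "group (tree_aut n)"
proof -
  let ?V = "tree_verts n"
  interpret B: group "BijGroup ?V" by (rule group_BijGroup)
  have root: "f [] = [] \<longleftrightarrow> (\<forall>u\<in>?V. f u = [] \<longleftrightarrow> u = [])" if "f \<in> Bij ?V" for f
  proof
    assume "f [] = []"
    then show "\<forall>u\<in>?V. f u = [] \<longleftrightarrow> u = []"
      using that inj_on_eq_iff[of f ?V _ "[]"] by (simp add: Bij_def bij_betw_def)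
  qed simp
  have "carrier (tree_aut n) =
      {f \<in> Bij ?V. \<forall>u\<in>?V. \<forall>v\<in>?V. tree_adj (f u) (f v) \<longleftrightarrow> tree_adj u v} \<inter>
      {f \<in> Bij ?V. \<forall>u\<in>?V. \<forall>v\<in>?V. f u = [] \<longleftrightarrow> u = []}"
    by (auto simp: in_carrier_tree_aut_iff root)
  then have "subgroup (carrier (tree_aut n)) (BijGroup ?V)"
    using B.subgroups_Inter_pair[OF subgroup_relation_automorphisms[of ?V tree_adj]
        subgroup_relation_automorphisms[of ?V "\<lambda>u v. u = []"]] by simp
  then show ?thesis using B.subgroup_imp_group by (simp add: tree_aut_def)
qed

global_interpretation tree_aut: group "tree_aut n" for n
  by (rule group_tree_aut)

lemma tree_adj_Nil_left_iff: "tree_adj [] v \<longleftrightarrow> (\<exists>i. v = [i])"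
  by (auto simp: tree_adj_def)

lemma tree_adj_Nil_right_iff: "tree_adj v [] \<longleftrightarrow> (\<exists>i. v = [i])"
  by (auto simp: tree_adj_def)

lemma tree_adj_Cons_Cons_iff: "tree_adj (i # u) (j # v) \<longleftrightarrow> i = j \<and> tree_adj u v"
  by (auto simp: tree_adj_def)

section \<open>Automorphisms given by their sections\<close>

lemma nth_triple_closed:
  assumes "a \<in> C" "b \<in> C" "c \<in> C" "i \<in> {0, 1, 2 :: nat}"
  shows "[a, b, c] ! i \<in> C"
  using assms by auto

lemma from_sections_Nil: "from_sections n a b c \<pi> [] = []"
  by (simp add: from_sections_def)

lemma from_sections_Cons:
  "\<lbrakk>i \<in> {0, 1, 2}; v \<in> tree_verts n\<rbrakk>
     \<Longrightarrow> from_sections (Suc n) a b c \<pi> (i # v) = \<pi> i # ([a, b, c] ! i) v"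
  by (simp add: from_sections_def Cons_in_tree_verts_iff)

context
  fixes n :: nat and a b c :: "nat list \<Rightarrow> nat list" and \<pi> :: "nat \<Rightarrow> nat"
  assumes sections:
      "a \<in> carrier (tree_aut n)" "b \<in> carrier (tree_aut n)" "c \<in> carrier (tree_aut n)"
    and perm: "\<pi> permutes {0, 1, 2}"
begin

private lemmas section_carrier = nth_triple_closed[OF sections]

lemma from_sections_closed:
  assumes "w \<in> tree_verts (Suc n)"
  shows "from_sections (Suc n) a b c \<pi> w \<in> tree_verts (Suc n)"
  using assms
proof (cases rule: tree_verts_Suc_cases)
  case (Cons i v)
  then show ?thesis
    using permutes_in_image[OF perm] tree_aut_closed[OF section_carrier]
    by (simp only: from_sections_Cons Cons_in_tree_verts_iff)
qed (simp add: from_sections_Nil)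

lemma inj_on_from_sections: "inj_on (from_sections (Suc n) a b c \<pi>) (tree_verts (Suc n))"
proof (rule inj_onI)
  fix u v
  assume u: "u \<in> tree_verts (Suc n)" and v: "v \<in> tree_verts (Suc n)"
    and eq: "from_sections (Suc n) a b c \<pi> u = from_sections (Suc n) a b c \<pi> v"
  from u v show "u = v"
  proof (cases rule: tree_verts_Suc_cases[case_product tree_verts_Suc_cases])
    case (Cons_Cons i u' j v')
    then have "\<pi> i = \<pi> j" and tail: "([a, b, c] ! i) u' = ([a, b, c] ! j) v'"
      using eq by (simp_all only: from_sections_Cons list.inject)
    then have "i = j" using permutes_inj[OF perm] by (simp add: inj_eq)
    then show ?thesis
      using tail tree_aut_eq_iff[OF section_carrier] Cons_Cons by blast
  qed (use eq in \<open>simp_all add: from_sections_Nil from_sections_Cons del: insert_iff\<close>)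
qed

lemma from_sections_adj_iff:
  assumes "u \<in> tree_verts (Suc n)" "v \<in> tree_verts (Suc n)"
  shows "tree_adj (from_sections (Suc n) a b c \<pi> u) (from_sections (Suc n) a b c \<pi> v)
    \<longleftrightarrow> tree_adj u v"
  using assms
proof (cases rule: tree_verts_Suc_cases[case_product tree_verts_Suc_cases])
  case Nil_Nil
  then show ?thesis by (simp add: from_sections_Nil)
next
  case (Nil_Cons j v')
  then show ?thesis
    using tree_aut_eq_Nil_iff[OF section_carrier, of j v']
    by (simp add: from_sections_Nil from_sections_Cons tree_adj_Nil_left_iff del: insert_iff)
next
  case (Cons_Nil i u')
  then show ?thesis
    using tree_aut_eq_Nil_iff[OF section_carrier, of i u']
    by (simp add: from_sections_Nil from_sections_Cons tree_adj_Nil_right_iff del: insert_iff)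
next
  case (Cons_Cons i u' j v')
  have "\<pi> i = \<pi> j \<longleftrightarrow> i = j" using permutes_inj[OF perm] by (simp add: inj_eq)
  then show ?thesis
    using Cons_Cons tree_aut_adj_iff[OF section_carrier, of i u' v']
    by (auto simp: from_sections_Cons tree_adj_Cons_Cons_iff simp del: insert_iff)
qed

lemma from_sections_carrier [simp]:
  "from_sections (Suc n) a b c \<pi> \<in> carrier (tree_aut (Suc n))"
  using from_sections_closed inj_on_from_sections from_sections_adj_iff
  by (intro tree_aut_carrierI) (simp_all add: from_sections_Nil, simp add: from_sections_def)

end

lemma from_sections_mult:
  assumes s: "a \<in> carrier (tree_aut n)" "b \<in> carrier (tree_aut n)" "c \<in> carrier (tree_aut n)"
    and s': "a' \<in> carrier (tree_aut n)" "b' \<in> carrier (tree_aut n)" "c' \<in> carrier (tree_aut n)"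
    and \<pi>: "\<pi> permutes {0, 1, 2}" and \<rho>: "\<rho> permutes {0, 1, 2}"
  shows "from_sections (Suc n) a b c \<pi> \<otimes>\<^bsub>tree_aut (Suc n)\<^esub> from_sections (Suc n) a' b' c' \<rho> =
    from_sections (Suc n) (([a, b, c] ! \<rho> 0) \<otimes>\<^bsub>tree_aut n\<^esub> a')
      (([a, b, c] ! \<rho> 1) \<otimes>\<^bsub>tree_aut n\<^esub> b') (([a, b, c] ! \<rho> 2) \<otimes>\<^bsub>tree_aut n\<^esub> c') (\<pi> \<circ> \<rho>)"
    (is "?f \<otimes>\<^bsub>_\<^esub> ?g = ?h")
proof -
  let ?V = "tree_verts (Suc n)"
  have "compose ?V ?f ?g = ?h"
  proof (rule extensionalityI[of _ ?V])
    fix w assume w: "w \<in> ?V"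
    then show "compose ?V ?f ?g w = ?h w"
    proof (cases w rule: tree_verts_Suc_cases)
      case (Cons i v)
      have \<rho>i: "\<rho> i \<in> {0, 1, 2}" by (rule iffD2[OF permutes_in_image[OF \<rho>] Cons(2)])
      note left = nth_triple_closed[OF s \<rho>i] and right = nth_triple_closed[OF s' Cons(2)]
      have "compose ?V ?f ?g w = ?f (?g w)" using w by (rule compose_eq)
      also have "?g w = \<rho> i # ([a', b', c'] ! i) v"
        unfolding Cons(1) by (rule from_sections_Cons[OF Cons(2,3)])
      also have "?f \<dots> = \<pi> (\<rho> i) # ([a, b, c] ! \<rho> i) (([a', b', c'] ! i) v)"
        by (rule from_sections_Cons[OF \<rho>i tree_aut_closed[OF right Cons(3)]])
      also have "\<dots> = \<pi> (\<rho> i) # (([a, b, c] ! \<rho> i) \<otimes>\<^bsub>tree_aut n\<^esub> ([a', b', c'] ! i)) v"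
        using Cons(3) by (simp add: tree_aut_mult[OF left right] compose_eq)
      also have "\<dots> = ?h w"
        using Cons(2,3) unfolding Cons(1) from_sections_Cons[OF Cons(2,3)] by auto
      finally show ?thesis .
    qed (simp add: compose_eq from_sections_Nil)
  qed (simp_all add: from_sections_def)
  then show ?thesis using s s' \<pi> \<rho> by (simp add: tree_aut_mult)
qed

lemma from_sections_one:
  "from_sections (Suc n) (tree_id n) (tree_id n) (tree_id n) id = tree_id (Suc n)"
proof
  fix w
  show "from_sections (Suc n) (tree_id n) (tree_id n) (tree_id n) id w = tree_id (Suc n) w"
    by (cases w) (auto simp: tree_aut_one from_sections_def Cons_in_tree_verts_iff)
qed

lemma tree_embed_Suc: "tree_embed (Suc n) a = from_sections (Suc n) a (tree_id n) (tree_id n) id"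
  by (simp add: tree_embed_def)

section \<open>The parity of the action on the first level\<close>

definition root_perm :: "(nat list \<Rightarrow> nat list) \<Rightarrow> nat \<Rightarrow> nat" where
  "root_perm f i = (if i \<in> {0, 1, 2} then hd (f [i]) else i)"

lemma tree_aut_singleton:
  assumes f: "f \<in> carrier (tree_aut (Suc n))" and i: "i \<in> {0, 1, 2}"
  shows "f [i] = [root_perm f i]" and "root_perm f i \<in> {0, 1, 2}"
proof -
  have "[i] \<in> tree_verts (Suc n)" using i by (simp only: singleton_in_tree_verts_iff)
  then have "tree_adj (f []) (f [i])" and closed: "f [i] \<in> tree_verts (Suc n)"
    using tree_aut_adj_iff[OF f, of "[]" "[i]"] tree_aut_closed[OF f, of "[i]"]
    by (simp_all add: tree_adj_Nil_left_iff)
  then obtain j where "f [i] = [j]" using tree_aut_Nil[OF f] by (auto simp: tree_adj_Nil_left_iff)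
  then show "f [i] = [root_perm f i]" using i by (simp add: root_perm_def)
  then show "root_perm f i \<in> {0, 1, 2}" using closed by (simp only: singleton_in_tree_verts_iff)
qed

lemma root_perm_permutes:
  assumes f: "f \<in> carrier (tree_aut (Suc n))"
  shows "root_perm f permutes {0, 1, 2}"
proof (rule bij_imp_permutes)
  have "inj_on (root_perm f) {0, 1, 2}"
  proof (rule inj_onI)
    fix i j assume ij: "i \<in> {0, 1, 2}" "j \<in> {0, 1, 2}" "root_perm f i = root_perm f j"
    then have "f [i] = f [j]" by (simp only: tree_aut_singleton(1)[OF f])
    moreover have "[i] \<in> tree_verts (Suc n)" "[j] \<in> tree_verts (Suc n)"
      using ij by (simp_all only: singleton_in_tree_verts_iff)
    ultimately show "i = j" using tree_aut_eq_iff[OF f] by simp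
  qed
  moreover have "root_perm f ` {0, 1, 2} \<subseteq> {0, 1, 2}"
    using tree_aut_singleton(2)[OF f] by (rule image_subsetI)
  ultimately show "bij_betw (root_perm f) {0, 1, 2} {0, 1, 2}"
    using endo_inj_surj[of "{0, 1, 2}" "root_perm f"] by (simp add: bij_betw_def)
qed (simp add: root_perm_def)

lemma root_perm_mult:
  assumes f: "f \<in> carrier (tree_aut (Suc n))" and g: "g \<in> carrier (tree_aut (Suc n))"
  shows "root_perm (f \<otimes>\<^bsub>tree_aut (Suc n)\<^esub> g) = root_perm f \<circ> root_perm g"
proof
  fix i
  show "root_perm (f \<otimes>\<^bsub>tree_aut (Suc n)\<^esub> g) i = (root_perm f \<circ> root_perm g) i"
  proof (cases "i \<in> {0, 1, 2}")
    case True
    then have "[i] \<in> tree_verts (Suc n)" by (simp only: singleton_in_tree_verts_iff)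
    then have "(f \<otimes>\<^bsub>tree_aut (Suc n)\<^esub> g) [i] = [root_perm f (root_perm g i)]"
      using tree_aut_singleton[OF g True] tree_aut_singleton(1)[OF f]
      by (simp only: tree_aut_mult[OF f g] compose_eq)
    then show ?thesis using True by (simp add: root_perm_def[of "f \<otimes>\<^bsub>_\<^esub> g"])
  qed (auto simp: root_perm_def)
qed

lemma root_perm_one: "root_perm (tree_id (Suc n)) = id"
  by (auto simp: root_perm_def tree_aut_one Cons_in_tree_verts_iff fun_eq_iff)

lemma root_perm_from_sections:
  assumes "\<pi> permutes {0, 1, 2}"
  shows "root_perm (from_sections (Suc n) a b c \<pi>) = \<pi>"
proof
  fix i
  show "root_perm (from_sections (Suc n) a b c \<pi>) i = \<pi> i"
    using permutes_not_in[OF assms, of i] by (simp add: root_perm_def from_sections_Cons)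
qed

lemma subgroup_even_root_perm:
  "subgroup {g \<in> carrier (tree_aut (Suc n)). evenperm (root_perm g)} (tree_aut (Suc n))"
    (is "subgroup ?E ?G")
proof (rule tree_aut.subgroupI)
  have even_mult: "evenperm (root_perm (f \<otimes>\<^bsub>?G\<^esub> g)) \<longleftrightarrow>
      evenperm (root_perm f) = evenperm (root_perm g)"
    if "f \<in> carrier ?G" "g \<in> carrier ?G" for f g
    using that permutes_imp_permutation[OF _ root_perm_permutes]
    by (simp add: root_perm_mult evenperm_comp)
  have "tree_id (Suc n) \<in> ?E" by (simp add: root_perm_one)
  then show "?E \<noteq> {}" by blast
  show "inv\<^bsub>?G\<^esub> g \<in> ?E" if "g \<in> ?E" for g
    using that even_mult[of g "inv\<^bsub>?G\<^esub> g"] by (simp add: root_perm_one)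
  show "f \<otimes>\<^bsub>?G\<^esub> g \<in> ?E" if "f \<in> ?E" "g \<in> ?E" for f g
    using that even_mult[of f g] by simp
qed blast

section \<open>The generators and their conjugation relations\<close>

definition rotation :: "nat \<Rightarrow> nat" where
  "rotation = cycle_of_list [0, 1, 2]"

definition reflection :: "nat \<Rightarrow> nat" where
  "reflection = cycle_of_list [0, 1]"

lemma rotation_permutes [simp]: "rotation permutes {0, 1, 2}"
  using cycle_permutes[of "[0, 1, 2]"] by (simp add: rotation_def)

lemma reflection_permutes [simp]: "reflection permutes {0, 1, 2}"
  using permutes_subset[OF cycle_permutes[of "[0, 1]"], of "{0, 1, 2}"]
  by (simp add: reflection_def)

lemma rotation_apply [simp]: "rotation 0 = 1" "rotation 1 = 2" "rotation 2 = 0"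
  by (simp_all add: rotation_def transpose_def)

lemma reflection_apply [simp]: "reflection 0 = 1" "reflection 1 = 0" "reflection 2 = 2"
  by (simp_all add: reflection_def transpose_def)

lemma reflection_reflection: "reflection \<circ> reflection = id"
  by (simp add: reflection_def)

lemma rotation_reflection_rotation: "rotation \<circ> (reflection \<circ> rotation) = reflection"
  by (auto simp: rotation_def reflection_def transpose_def)

lemma evenperm_rotation: "evenperm rotation"
  by (simp add: rotation_def evenperm_comp permutation_swap_id evenperm_swap)

lemma not_evenperm_reflection: "\<not> evenperm reflection"
  by (simp add: reflection_def evenperm_swap)

text \<open>The dummies at index \<open>0\<close> make the recursion hold from the trivial level on.\<close>

lemma x_elt_Suc:
  "x_elt (Suc n) = from_sections (Suc n) (tree_id n) (tree_id n) (x_elt n) rotation"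
  by (cases n) (simp_all add: level_one_def rotation_def One_nat_def)

lemma y_elt_Suc:
  "y_elt (Suc n) = from_sections (Suc n) (tree_id n) (y_elt n) (x_elt n) reflection"
  by (cases n) (simp_all add: level_one_def reflection_def One_nat_def)

lemma z_elt_Suc: "z_elt (Suc n) = from_sections (Suc n) (y_elt n) (y_elt n) (x_elt n) id"
  using from_sections_one[of 0] by (cases n) (simp_all add: One_nat_def)

lemma x_elt_carrier [simp]: "x_elt n \<in> carrier (tree_aut n)"
  by (induction n) (simp_all add: x_elt_Suc)

lemma y_elt_carrier [simp]: "y_elt n \<in> carrier (tree_aut n)"
  by (induction n) (simp_all add: y_elt_Suc)

lemma z_elt_carrier [simp]: "z_elt n \<in> carrier (tree_aut n)"
  by (cases n) (simp_all add: z_elt_Suc)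

context
  fixes n :: nat
begin

private abbreviation (input) G where "G \<equiv> tree_aut n"
private abbreviation (input) G' where "G' \<equiv> tree_aut (Suc n)"
private abbreviation (input) F where "F \<equiv> from_sections (Suc n)"
private abbreviation (input) e where "e \<equiv> tree_id n"
private abbreviation (input) x where "x \<equiv> x_elt n"
private abbreviation (input) y where "y \<equiv> y_elt n"
private abbreviation (input) X where "X \<equiv> x_elt (Suc n)"
private abbreviation (input) Y where "Y \<equiv> y_elt (Suc n)"
private abbreviation (input) Z where "Z \<equiv> z_elt (Suc n)"

lemma x_elt_conj_sections:
  assumes [simp]: "a \<in> carrier G" "b \<in> carrier G" "c \<in> carrier G"
  shows "X \<otimes>\<^bsub>G'\<^esub> F a b c id \<otimes>\<^bsub>G'\<^esub> inv\<^bsub>G'\<^esub> X = F (x \<otimes>\<^bsub>G\<^esub> c \<otimes>\<^bsub>G\<^esub> inv\<^bsub>G\<^esub> x) a b id"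
proof -
  have "X \<otimes>\<^bsub>G'\<^esub> F a b c id = F (x \<otimes>\<^bsub>G\<^esub> c \<otimes>\<^bsub>G\<^esub> inv\<^bsub>G\<^esub> x) a b id \<otimes>\<^bsub>G'\<^esub> X"
    by (simp add: x_elt_Suc from_sections_mult tree_aut.m_assoc)
  then show ?thesis by (simp add: tree_aut.inv_solve_right')
qed

lemma y_elt_conj_sections:
  assumes [simp]: "a \<in> carrier G" "b \<in> carrier G" "c \<in> carrier G"
  shows "Y \<otimes>\<^bsub>G'\<^esub> F a b c id \<otimes>\<^bsub>G'\<^esub> inv\<^bsub>G'\<^esub> Y =
    F (y \<otimes>\<^bsub>G\<^esub> b \<otimes>\<^bsub>G\<^esub> inv\<^bsub>G\<^esub> y) a (x \<otimes>\<^bsub>G\<^esub> c \<otimes>\<^bsub>G\<^esub> inv\<^bsub>G\<^esub> x) id"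
proof -
  have "Y \<otimes>\<^bsub>G'\<^esub> F a b c id =
      F (y \<otimes>\<^bsub>G\<^esub> b \<otimes>\<^bsub>G\<^esub> inv\<^bsub>G\<^esub> y) a (x \<otimes>\<^bsub>G\<^esub> c \<otimes>\<^bsub>G\<^esub> inv\<^bsub>G\<^esub> x) id \<otimes>\<^bsub>G'\<^esub> Y"
    by (simp add: y_elt_Suc from_sections_mult tree_aut.m_assoc)
  then show ?thesis by (simp add: tree_aut.inv_solve_right')
qed

lemma y_elt_conj_z_elt: "Y \<otimes>\<^bsub>G'\<^esub> Z \<otimes>\<^bsub>G'\<^esub> inv\<^bsub>G'\<^esub> Y = Z"
  using y_elt_conj_sections[of y y x] by (simp add: z_elt_Suc tree_aut.m_assoc[where n = n])

lemma y_elt_square: "Y \<otimes>\<^bsub>G'\<^esub> Y = Z \<otimes>\<^bsub>G'\<^esub> F e e x id"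
  by (simp add: y_elt_Suc z_elt_Suc from_sections_mult reflection_reflection)

lemma y_elt_conj_x_elt:
  "Y \<otimes>\<^bsub>G'\<^esub> X \<otimes>\<^bsub>G'\<^esub> inv\<^bsub>G'\<^esub> Y =
    inv\<^bsub>G'\<^esub> X \<otimes>\<^bsub>G'\<^esub> (F (x \<otimes>\<^bsub>G\<^esub> x \<otimes>\<^bsub>G\<^esub> inv\<^bsub>G\<^esub> (y \<otimes>\<^bsub>G\<^esub> y)) e (inv\<^bsub>G\<^esub> x) id \<otimes>\<^bsub>G'\<^esub> Z)"
proof -
  let ?w = "F (x \<otimes>\<^bsub>G\<^esub> x \<otimes>\<^bsub>G\<^esub> inv\<^bsub>G\<^esub> (y \<otimes>\<^bsub>G\<^esub> y)) e (inv\<^bsub>G\<^esub> x) id \<otimes>\<^bsub>G'\<^esub> Z"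
  have "X \<otimes>\<^bsub>G'\<^esub> (Y \<otimes>\<^bsub>G'\<^esub> X) = F y (x \<otimes>\<^bsub>G\<^esub> x) x reflection"
    by (simp add: x_elt_Suc y_elt_Suc from_sections_mult permutes_compose
        rotation_reflection_rotation)
  also have "\<dots> = ?w \<otimes>\<^bsub>G'\<^esub> Y"
    by (simp add: y_elt_Suc z_elt_Suc from_sections_mult tree_aut.inv_mult_group tree_aut.m_assoc)
  finally have "Y \<otimes>\<^bsub>G'\<^esub> X = inv\<^bsub>G'\<^esub> X \<otimes>\<^bsub>G'\<^esub> (?w \<otimes>\<^bsub>G'\<^esub> Y)"
    by (simp add: tree_aut.inv_solve_left)
  then show ?thesis by (simp add: tree_aut.inv_solve_right' tree_aut.m_assoc)
qed

end

section \<open>The groups generated\<close>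

definition L_generators :: "nat \<Rightarrow> (nat list \<Rightarrow> nat list) set" where
  "L_generators n = {x_elt n, z_elt n} \<union> tree_embed n ` L_grp (n - 1)"

lemma L_grp_Suc: "L_grp (Suc n) = generate (tree_aut (Suc n)) (L_generators (Suc n))"
  by (simp add: L_generators_def)

declare L_grp.simps(2) [simp del]

lemma M_grp_eq_generate: "M_grp n = generate (tree_aut n) (insert (y_elt n) (L_generators n))"
  unfolding M_grp_def L_generators_def by (simp add: insert_commute)

lemma L_generators_Suc_cases [consumes 1, case_names x_elt z_elt embed]:
  assumes "s \<in> L_generators (Suc n)"
  obtains "s = x_elt (Suc n)" | "s = z_elt (Suc n)"
    | a where "a \<in> L_grp n" "s = from_sections (Suc n) a (tree_id n) (tree_id n) id"
  using assms by (auto simp: L_generators_def tree_embed_Suc)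

lemma subgroup_L_grp: "subgroup (L_grp n) (tree_aut n)"
proof (induction n)
  case 0
  show ?case using tree_aut.triv_subgroup[of 0] by simp
next
  case (Suc n)
  have "L_generators (Suc n) \<subseteq> carrier (tree_aut (Suc n))"
    using subgroup.mem_carrier[OF Suc.IH] by (auto elim!: L_generators_Suc_cases)
  then show ?case unfolding L_grp_Suc by (rule tree_aut.generate_is_subgroup)
qed

lemmas L_grp_carrier = subgroup.mem_carrier[OF subgroup_L_grp]
  and L_grp_mult = subgroup.m_closed[OF subgroup_L_grp]
  and L_grp_inv = subgroup.m_inv_closed[OF subgroup_L_grp]
  and L_grp_one = subgroup.one_closed[OF subgroup_L_grp]

lemma L_generators_carrier: "L_generators (Suc n) \<subseteq> carrier (tree_aut (Suc n))"
  by (auto elim!: L_generators_Suc_cases dest: L_grp_carrier)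

lemma x_elt_in_L_grp: "x_elt n \<in> L_grp n"
  by (cases n) (auto simp: L_grp_Suc L_generators_def intro: generate.incl)

lemma z_elt_in_L_grp: "z_elt n \<in> L_grp n"
  by (cases n) (auto simp: L_grp_Suc L_generators_def intro: generate.incl)

lemma from_sections_in_L_grp:
  assumes a: "a \<in> L_grp n" and b: "b \<in> L_grp n" and c: "c \<in> L_grp n"
  shows "from_sections (Suc n) a b c id \<in> L_grp (Suc n)"
proof -
  let ?F = "\<lambda>a b c. from_sections (Suc n) a b c id" and ?e = "tree_id n" and ?X = "x_elt (Suc n)"
  let ?G = "tree_aut (Suc n)"
  note [simp] = L_grp_carrier
  have X_conj: "?X \<otimes>\<^bsub>?G\<^esub> g \<otimes>\<^bsub>?G\<^esub> inv\<^bsub>?G\<^esub> ?X \<in> L_grp (Suc n)" if "g \<in> L_grp (Suc n)" for g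
    using that by (intro L_grp_mult L_grp_inv x_elt_in_L_grp)
  have first: "?F g ?e ?e \<in> L_grp (Suc n)" if "g \<in> L_grp n" for g
    using that by (auto simp: L_grp_Suc L_generators_def tree_embed_Suc intro: generate.incl)
  have second: "?F ?e g ?e \<in> L_grp (Suc n)" if "g \<in> L_grp n" for g
    using X_conj[OF first[OF that]] that by (simp add: x_elt_conj_sections)
  have third: "?F ?e ?e g \<in> L_grp (Suc n)" if "g \<in> L_grp n" for g
    using X_conj[OF second[OF that]] that by (simp add: x_elt_conj_sections)
  have "?F a b c = ?F a ?e ?e \<otimes>\<^bsub>?G\<^esub> ?F ?e b ?e \<otimes>\<^bsub>?G\<^esub> ?F ?e ?e c"
    using a b c by (simp add: from_sections_mult)
  also have "\<dots> \<in> L_grp (Suc n)" by (intro L_grp_mult first[OF a] second[OF b] third[OF c])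
  finally show ?thesis .
qed

lemma y_elt_square_in_L_grp: "y_elt n \<otimes>\<^bsub>tree_aut n\<^esub> y_elt n \<in> L_grp n"
proof (cases n)
  case (Suc m)
  show ?thesis
    unfolding Suc y_elt_square
    by (intro L_grp_mult z_elt_in_L_grp from_sections_in_L_grp L_grp_one x_elt_in_L_grp)
qed simp

lemma y_elt_conj_L_generators:
  assumes "s \<in> L_generators (Suc n)"
  shows "y_elt (Suc n) \<otimes>\<^bsub>tree_aut (Suc n)\<^esub> s \<otimes>\<^bsub>tree_aut (Suc n)\<^esub>
    inv\<^bsub>tree_aut (Suc n)\<^esub> y_elt (Suc n) \<in> L_grp (Suc n)"
  using assms
proof (cases rule: L_generators_Suc_cases)
  case x_elt
  show ?thesis
    unfolding x_elt y_elt_conj_x_elt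
    by (intro L_grp_mult L_grp_inv from_sections_in_L_grp L_grp_one
        x_elt_in_L_grp z_elt_in_L_grp y_elt_square_in_L_grp)
next
  case z_elt
  then show ?thesis by (simp add: y_elt_conj_z_elt z_elt_in_L_grp)
next
  case (embed a)
  then show ?thesis
    by (simp add: y_elt_conj_sections L_grp_carrier from_sections_in_L_grp L_grp_one)
qed

lemma evenperm_root_perm_L_grp:
  assumes "g \<in> L_grp (Suc n)"
  shows "evenperm (root_perm g)"
proof -
  have "L_generators (Suc n) \<subseteq> {g \<in> carrier (tree_aut (Suc n)). evenperm (root_perm g)}"
  proof
    fix s assume "s \<in> L_generators (Suc n)"
    then show "s \<in> {g \<in> carrier (tree_aut (Suc n)). evenperm (root_perm g)}"
      by (cases rule: L_generators_Suc_cases)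
        (simp_all add: L_grp_carrier x_elt_Suc z_elt_Suc root_perm_from_sections evenperm_rotation)
  qed
  then show ?thesis
    using tree_aut.generate_subgroup_incl[OF _ subgroup_even_root_perm] assms
    unfolding L_grp_Suc by blast
qed

lemma y_elt_notin_L_grp: "y_elt (Suc n) \<notin> L_grp (Suc n)"
  using evenperm_root_perm_L_grp[of "y_elt (Suc n)" n] not_evenperm_reflection
  by (auto simp: y_elt_Suc root_perm_from_sections)

theorem theorem3p7:
  fixes n :: nat
  assumes "n \<ge> 1"
  shows "L_grp n \<lhd> (tree_aut n)\<lparr>carrier := M_grp n\<rparr> \<and>
         card (rcosets\<^bsub>(tree_aut n)\<lparr>carrier := M_grp n\<rparr>\<^esub> (L_grp n)) = 2"
proof -
  obtain m where n: "n = Suc m" using assms by (cases n) auto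
  note index_two = tree_aut.generate_insert_index_two[OF L_generators_carrier y_elt_carrier,
      folded L_grp_Suc M_grp_eq_generate,
      OF y_elt_conj_L_generators y_elt_square_in_L_grp y_elt_notin_L_grp]
  show ?thesis unfolding n by (intro conjI index_two)
qed

end
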